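(* Let $R$ be a commutative unitary ring and $x,y\in R$, and let $Id$ be the identity operator on $\mathcal{S}(R)$. Then the following identities of operators on $\mathcal{S}(R)$ hold: (1) $I^{(x)}\circ I^{(-x)}=Id$ and $L^{(x)}\circ L^{(-x)}=Id$; (2) $I^{(x)}\circ I^{(y)}=I^{(x+y)}$ and $L^{(x)}\circ L^{(y)}=L^{(x+y)}$; (3) $I^{(x)}\circ\varepsilon=\varepsilon\circ I^{(-x)}$ and $L^{(x)}\circ\varepsilon=\varepsilon\circ L^{(-x)}$; (4) $I^{(x)}\circ L^{(y)}=L^{(y)}\circ I^{(x)}$; (5) $I^{(x)}\circ\eta=\eta\circ L^{(-x)}$ and $\eta\circ I^{(x)}=L^{(-x)}\circ\eta$; (6) $\gamma\circ I^{(x)}\circ\gamma^{-1}=L^{(x)}$ and $\gamma\circ L^{(x)}\circ\gamma^{-1}=I^{(x)}$.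
   Context: Let $\mathcal{S}(R)$ be the set of sequences $A=\{a_n\}_{n=0}^{\infty}$ of elements of $R$ with $a_0=1$. For $A\in\mathcal{S}(R)$ put $\lambda(A)=\sum_{n\ge 0}a_nt^{n+1}\in R[[t]]$. Composition of series is $f\circ g=f(g(t))$, and $\mathcal{S}(R)$ is a group under $A\bullet B=\lambda^{-1}(\lambda(A)\circ\lambda(B))$; $A^{-1}$ denotes the inverse in this group. Operators on $\mathcal{S}(R)$: $\eta(A)=A^{-1}$ (Revert), $\varepsilon(\{a_n\}_{n\ge0})=\{(-1)^na_n\}_{n\ge0}$, $\gamma=\eta\circ\varepsilon$. The interpolated Invert operator $I^{(x)}$ sends $A=\{a_n\}$ to the sequence with ordinary generating function $\dfrac{\sum_{n\ge0}a_nt^n}{1-xt\sum_{n\ge0}a_nt^n}$. The interpolated Binomial operator $L^{(x)}$ sends $A=\{a_n\}$ to $\{l_n\}_{n\ge0}$ with $l_n=\sum_{j=0}^n\binom{n}{j}x^{n-j}a_j$. Between operators, $\circ$ is the usual composition of maps and $\gamma^{-1}$ is the inverse map. *)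

theory Defs
  imports "HOL-Computational_Algebra.Formal_Power_Series" "HOL-Algebra.Group"
begin

typedef (overloaded) 'a seq1 = "{a :: nat \<Rightarrow> 'a::comm_ring_1. a 0 = 1}"
  morphisms seq_nth Abs_seq1
  by (rule exI[of _ "\<lambda>_. 1"]) simp

lemma seq_nth_0 [simp]: "seq_nth A 0 = 1"
  using seq_nth[of A] by simp

definition ogf :: "'a::comm_ring_1 seq1 \<Rightarrow> 'a fps" where
  "ogf A = Abs_fps (seq_nth A)"

definition lam :: "'a::comm_ring_1 seq1 \<Rightarrow> 'a fps" where
  "lam A = Abs_fps (\<lambda>n. if n = 0 then 0 else seq_nth A (n - 1))"

lemma lam_eq: "lam A = fps_X * ogf A"
  by (simp add: lam_def ogf_def fps_eq_iff)

lemma inj_lam: "inj lam"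
proof (rule injI)
  fix A B :: "'a seq1"
  assume "lam A = lam B"
  then have "fps_nth (lam A) (Suc n) = fps_nth (lam B) (Suc n)" for n by (rule arg_cong)
  then have "seq_nth A = seq_nth B" by (simp add: lam_def fun_eq_iff)
  then show "A = B" by (simp add: seq_nth_inject)
qed

lemma range_lam: "range lam = {f :: 'a::comm_ring_1 fps. fps_nth f 0 = 0 \<and> fps_nth f 1 = 1}"
proof (intro subset_antisym subsetI)
  fix f :: "'a fps"
  assume f: "f \<in> {f. fps_nth f 0 = 0 \<and> fps_nth f 1 = 1}"
  then have "lam (Abs_seq1 (\<lambda>n. fps_nth f (Suc n))) = f"
    by (auto simp: lam_def fps_eq_iff Abs_seq1_inverse)
  then show "f \<in> range lam" by (metis rangeI)
qed (auto simp: lam_def)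

text \<open>In HOL-Algebra, \<open>inv\<close> is taken by \<^const>\<open>m_inv\<close>; inverse maps are written
  with \<^const>\<open>inv_into\<close>.\<close>

definition bullet :: "'a::comm_ring_1 seq1 \<Rightarrow> 'a seq1 \<Rightarrow> 'a seq1" where
  "bullet A B = inv_into UNIV lam (lam A oo lam B)"

definition seq_group :: "'a::comm_ring_1 seq1 monoid" where
  "seq_group = \<lparr>carrier = UNIV, mult = bullet, one = inv_into UNIV lam fps_X\<rparr>"

definition eta_op :: "'a::comm_ring_1 seq1 \<Rightarrow> 'a seq1" where
  "eta_op A = m_inv seq_group A"

definition eps_op :: "'a::comm_ring_1 seq1 \<Rightarrow> 'a seq1" where
  "eps_op A = Abs_seq1 (\<lambda>n. (- 1) ^ n * seq_nth A n)"

definition gamma_op :: "'a::comm_ring_1 seq1 \<Rightarrow> 'a seq1" where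
  "gamma_op = eta_op \<circ> eps_op"

text \<open>\<^const>\<open>inverse\<close> on power series needs an \<open>inverse\<close> operation on the coefficients, so
  over a commutative ring the quotient is formed with \<^term>\<open>fps_right_inverse f 1\<close>, which is the
  reciprocal of any \<open>f\<close> with constant coefficient \<open>1\<close>.\<close>

definition invert_op :: "'a::comm_ring_1 \<Rightarrow> 'a seq1 \<Rightarrow> 'a seq1" where
  "invert_op x A =
     Abs_seq1 (fps_nth (ogf A * fps_right_inverse (1 - fps_const x * fps_X * ogf A) 1))"

definition binomial_op :: "'a::comm_ring_1 \<Rightarrow> 'a seq1 \<Rightarrow> 'a seq1" where
  "binomial_op x A =
     Abs_seq1 (\<lambda>n. \<Sum>j = 0..n. of_nat (n choose j) * x ^ (n - j) * seq_nth A j)"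

text \<open>The arguments of \<^const>\<open>Abs_seq1\<close> and \<^term>\<open>inv_into UNIV lam\<close> above are in the
  proper domain, so the definitions mean what they say.\<close>

lemma lam_bullet: "lam (bullet A B) = lam A oo lam B"
  unfolding bullet_def
  by (rule f_inv_into_f) (simp add: range_lam fps_compose_nth, simp add: lam_def)

lemma lam_one_seq_group: "lam (one seq_group) = (fps_X :: 'a::comm_ring_1 fps)"
  unfolding seq_group_def by (simp add: f_inv_into_f range_lam)

lemma seq_nth_eps_op: "seq_nth (eps_op A) n = (- 1) ^ n * seq_nth A n"
  by (simp add: eps_op_def Abs_seq1_inverse)

lemma ogf_invert_op:
  "ogf (invert_op x A) * (1 - fps_const x * fps_X * ogf A) = ogf A"
proof -
  let ?d = "1 - fps_const x * fps_X * ogf A"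
  have "seq_nth (invert_op x A) = fps_nth (ogf A * fps_right_inverse ?d 1)"
    unfolding invert_op_def by (rule Abs_seq1_inverse) (simp add: ogf_def)
  then have "ogf (invert_op x A) = ogf A * fps_right_inverse ?d 1"
    by (simp add: ogf_def fps_nth_inverse)
  then have "ogf (invert_op x A) * ?d = ogf A * (?d * fps_right_inverse ?d 1)"
    by (simp only: mult_ac)
  also have "?d * fps_right_inverse ?d 1 = 1"
    by (rule fps_right_inverse) simp
  finally show ?thesis by (simp only: mult_1_right)
qed

lemma seq_nth_binomial_op:
  "seq_nth (binomial_op x A) n = (\<Sum>j = 0..n. of_nat (n choose j) * x ^ (n - j) * seq_nth A j)"
  by (simp add: binomial_op_def Abs_seq1_inverse)

end

theory Submission
  imports Defs
begin

text \<open>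
  Both families of operators are translations in the group of sequences. Let \<open>geom x\<close> be the
  sequence of powers of \<open>x\<close>, so that \<open>\<lambda>(geom x) = t / (1 - x t)\<close>. The interpolated Invert operator
  replaces \<open>f = \<lambda>(A)\<close> by \<open>f / (1 - x f) = \<lambda>(geom x) \<circ> f\<close>, hence it is left multiplication by
  \<open>geom x\<close> (\<open>invert_op_eq_bullet\<close>). The interpolated Binomial operator replaces it by
  \<open>f (t / (1 - x t)) = f \<circ> \<lambda>(geom x)\<close>, hence it is right multiplication by \<open>geom x\<close>
  (\<open>binomial_op_eq_bullet\<close>).

  The binomial theorem says that \<open>x \<mapsto> geom x\<close> is a homomorphism from the additive group
  of the ring (\<open>bullet_geom_geom\<close>), and all the identities follow from this: left and right
  multiplications commute; \<open>eta_op\<close> is an anti-automorphism, so it exchanges the two kinds of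
  translation; \<open>eps_op\<close>, which is conjugation by \<open>t \<mapsto> - t\<close>, is an automorphism; and both
  send \<open>geom x\<close> to \<open>geom (- x)\<close>. In \<open>gamma_op\<close> the two changes of sign cancel.

  What remains is that the sequences form a group over a ring that may have zero divisors. This
  needs the associativity of composition of power series and the solvability of
  \<open>g \<circ> f = t\<close>. Both rest on the vanishing of the \<open>n\<close>th coefficient of \<open>f ^ i\<close> for \<open>i > n\<close>,
  which makes all the sums finite and the system for the coefficients of \<open>g\<close> triangular.
\<close>

section \<open>Composition of power series over a commutative ring\<close>

unbundle fps_syntax

text \<open>A summation bound that does not depend on the coefficient, so that the coefficients of a
  product of compositions can be summed over one common range and the sums exchanged.\<close>

lemma fps_compose_nth_atMost:
  fixes c :: "'a::comm_ring_1 fps"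
  assumes "c $ 0 = 0" "n \<le> N"
  shows "(a oo c) $ n = (\<Sum>i\<le>N. a $ i * (c ^ i) $ n)"
  unfolding fps_compose_nth using assms
  by (intro sum.mono_neutral_left) (auto simp: startsby_zero_power_prefix)

text \<open>Expanding both factors on the right, the Cauchy product of \<open>c ^ i\<close> and \<open>c ^ j\<close> collects to
  \<open>c ^ (i + j)\<close>; grouping by \<open>s = i + j\<close> gives the coefficients of \<open>a * b\<close>.\<close>

lemma fps_compose_mult_distrib_comm_ring:
  fixes a b c :: "'a::comm_ring_1 fps"
  assumes c0: "c $ 0 = 0"
  shows "(a * b) oo c = (a oo c) * (b oo c)"
proof (rule fps_ext)
  fix n
  have "((a oo c) * (b oo c)) $ n = (\<Sum>k=0..n. (a oo c) $ k * (b oo c) $ (n - k))"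
    by (simp add: fps_mult_nth)
  also have "\<dots> = (\<Sum>k=0..n. (\<Sum>i\<le>n. a $ i * (c ^ i) $ k) * (\<Sum>j\<le>n. b $ j * (c ^ j) $ (n - k)))"
    by (intro sum.cong refl arg_cong2[where f = "(*)"] fps_compose_nth_atMost c0) auto
  also have "\<dots> = (\<Sum>k=0..n. \<Sum>i\<le>n. \<Sum>j\<le>n. a $ i * b $ j * ((c ^ i) $ k * (c ^ j) $ (n - k)))"
    by (simp add: sum_product mult_ac)
  also have "\<dots> = (\<Sum>i\<le>n. \<Sum>j\<le>n. \<Sum>k=0..n. a $ i * b $ j * ((c ^ i) $ k * (c ^ j) $ (n - k)))"
    by (subst sum.swap, rule sum.cong[OF refl], rule sum.swap)
  also have "\<dots> = (\<Sum>i\<le>n. \<Sum>j\<le>n. a $ i * b $ j * (c ^ (i + j)) $ n)"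
    by (simp add: power_add fps_mult_nth sum_distrib_left)
  also have "\<dots> = (\<Sum>(i, j)\<in>{..n} \<times> {..n}. a $ i * b $ j * (c ^ (i + j)) $ n)"
    by (simp add: sum.cartesian_product)
  \<comment> \<open>Terms with \<open>i + j > n\<close> vanish because \<open>c ^ (i + j)\<close> has order at least \<open>i + j\<close>.\<close>
  also have "\<dots> = (\<Sum>(i, j)\<in>{(i, j). i + j \<le> n}. a $ i * b $ j * (c ^ (i + j)) $ n)"
    using startsby_zero_power_prefix[OF c0]
    by (intro sum.mono_neutral_right) (auto, metis mult_zero_right not_le)
  also have "\<dots> = (\<Sum>s\<le>n. \<Sum>i\<le>s. a $ i * b $ (s - i) * (c ^ s) $ n)"
    by (subst sum.triangle_reindex_eq) simp
  also have "\<dots> = ((a * b) oo c) $ n"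
    by (simp add: fps_compose_nth fps_mult_nth sum_distrib_right atLeast0AtMost)
  finally show "((a * b) oo c) $ n = ((a oo c) * (b oo c)) $ n" ..
qed

lemma fps_compose_power_comm_ring:
  fixes a c :: "'a::comm_ring_1 fps"
  assumes "c $ 0 = 0"
  shows "a ^ n oo c = (a oo c) ^ n"
  using assms by (induction n) (simp_all add: fps_compose_mult_distrib_comm_ring)

lemma fps_compose_assoc_comm_ring:
  fixes a b c :: "'a::comm_ring_1 fps"
  assumes b0: "b $ 0 = 0" and c0: "c $ 0 = 0"
  shows "(a oo b) oo c = a oo (b oo c)"
proof (rule fps_ext)
  fix n
  have "((a oo b) oo c) $ n = (\<Sum>i\<le>n. (\<Sum>j\<le>n. a $ j * (b ^ j) $ i) * (c ^ i) $ n)"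
    unfolding fps_compose_nth_atMost[OF c0 order_refl]
    by (intro sum.cong refl arg_cong2[where f = "(*)"] fps_compose_nth_atMost b0) auto
  also have "\<dots> = (\<Sum>j\<le>n. a $ j * (\<Sum>i\<le>n. (b ^ j) $ i * (c ^ i) $ n))"
    unfolding sum_distrib_right sum_distrib_left mult.assoc by (rule sum.swap)
  also have "\<dots> = (\<Sum>j\<le>n. a $ j * ((b oo c) ^ j) $ n)"
    by (simp add: fps_compose_power_comm_ring[OF c0, symmetric]
        fps_compose_nth_atMost[OF c0 order_refl])
  also have "\<dots> = (a oo (b oo c)) $ n"
    by (simp add: fps_compose_nth atLeast0AtMost)
  finally show "((a oo b) oo c) $ n = (a oo (b oo c)) $ n" .
qed

text \<open>The coefficients of the \<open>g\<close> with \<open>g oo f = h\<close>, for \<open>f\<close> of the form \<open>t + \<dots>\<close>: the linear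
  system for them is unitriangular, as \<open>f ^ n\<close> has order \<open>n\<close> and leading coefficient \<open>1\<close>.\<close>

fun compose_quotient_nth :: "'a::comm_ring_1 fps \<Rightarrow> 'a fps \<Rightarrow> nat \<Rightarrow> 'a" where
  "compose_quotient_nth h f n = h $ n - (\<Sum>i<n. compose_quotient_nth h f i * (f ^ i) $ n)"

declare compose_quotient_nth.simps [simp del]

lemma ex_compose_eq:
  fixes f h :: "'a::comm_ring_1 fps"
  assumes f0: "f $ 0 = 0" and f1: "f $ 1 = 1"
  shows "\<exists>g. g oo f = h"
proof
  show "Abs_fps (compose_quotient_nth h f) oo f = h"
  proof (rule fps_ext)
    fix n
    have "(Abs_fps (compose_quotient_nth h f) oo f) $ n =
        (\<Sum>i<n. compose_quotient_nth h f i * (f ^ i) $ n) + compose_quotient_nth h f n"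
      using startsby_zero_power_nth_same[OF f0, of n] f1
      by (simp add: fps_compose_nth atLeast0AtMost flip: lessThan_Suc_atMost)
    then show "(Abs_fps (compose_quotient_nth h f) oo f) $ n = h $ n"
      by (simp add: compose_quotient_nth.simps[of h f n])
  qed
qed

section \<open>The group of sequences\<close>

lemma lam_nth_0 [simp]: "lam A $ 0 = 0"
  and lam_nth_Suc [simp]: "lam A $ Suc n = seq_nth A n"
  by (simp_all add: lam_def)

lemma lam_inject: "lam A = lam B \<longleftrightarrow> A = B"
  using inj_lam by (auto dest: injD)

lemma seq1_eqI: "(\<And>n. seq_nth A n = seq_nth B n) \<Longrightarrow> A = B"
  by (simp add: seq_nth_inject[symmetric] fun_eq_iff)

lemma bullet_assoc: "bullet (bullet A B) C = bullet A (bullet B C)"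
  by (simp add: lam_inject[symmetric] lam_bullet fps_compose_assoc_comm_ring)

text \<open>Left inverses suffice for a group, and on the left the unknown series occurs linearly. The
  solution lies in the range of \<open>lam\<close>, as comparing the two lowest coefficients shows.\<close>

lemma ex_left_inverse_bullet: "\<exists>B. bullet B A = one seq_group"
proof -
  obtain g where g: "g oo lam A = fps_X"
    using ex_compose_eq[of "lam A" fps_X] by (auto simp: lam_def)
  have "g $ 0 = 0"
    using arg_cong[OF g, of "\<lambda>f. f $ 0"] by simp
  moreover have "g $ 1 = 1"
    using arg_cong[OF g, of "\<lambda>f. f $ 1"] \<open>g $ 0 = 0\<close> by (simp add: fps_compose_nth)
  ultimately obtain B where "g = lam B"
    using range_lam by blast
  with g show ?thesis
    by (auto simp: lam_inject[symmetric] lam_bullet lam_one_seq_group)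
qed

lemma group_seq_group: "group (seq_group :: 'a::comm_ring_1 seq1 monoid)"
proof (rule groupI)
  fix A :: "'a seq1"
  show "\<one>\<^bsub>seq_group\<^esub> \<otimes>\<^bsub>seq_group\<^esub> A = A"
    using lam_bullet[of "one seq_group" A]
    by (simp add: lam_inject[symmetric] lam_one_seq_group) (simp add: seq_group_def)
  show "\<exists>B\<in>carrier seq_group. B \<otimes>\<^bsub>seq_group\<^esub> A = \<one>\<^bsub>seq_group\<^esub>"
    using ex_left_inverse_bullet[of A] by (simp add: seq_group_def)
qed (simp_all add: seq_group_def bullet_assoc)

lemma carrier_seq_group [simp]: "carrier seq_group = UNIV"
  and mult_seq_group [simp]: "mult seq_group = bullet"
  by (simp_all add: seq_group_def)

lemma eta_op_bullet: "eta_op (bullet A B) = bullet (eta_op B) (eta_op A)"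
  using group.inv_mult_group[OF group_seq_group, of A B] by (simp add: eta_op_def)

lemma eta_op_eta_op: "eta_op (eta_op A) = A"
  using group.inv_inv[OF group_seq_group, of A] by (simp add: eta_op_def)

lemma eta_op_eqI: "bullet B A = one seq_group \<Longrightarrow> eta_op A = B"
  using group.inv_equality[OF group_seq_group, of B A] by (simp add: eta_op_def)

lemma eps_op_eps_op: "eps_op (eps_op A) = A"
  by (rule seq1_eqI) (simp add: seq_nth_eps_op flip: mult.assoc power_add)

text \<open>\<open>\<lambda>(\<epsilon> A) = - \<lambda>(A)(- t)\<close>, and both changes of sign pass through powers.\<close>

lemma lam_eps_op_power_nth: "(lam (eps_op A) ^ i) $ n = (- 1) ^ (n + i) * (lam A ^ i) $ n"
proof -
  have "lam (eps_op A) = - (lam A oo - fps_X)"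
  proof (rule fps_ext)
    show "lam (eps_op A) $ n = (- (lam A oo - fps_X)) $ n" for n
      by (cases n) (simp_all add: seq_nth_eps_op fps_compose_uminus')
  qed
  then have "lam (eps_op A) ^ i = (- 1) ^ i * (lam A ^ i oo - fps_X)"
    by (simp add: fps_compose_power_comm_ring power_minus[of "lam A oo - fps_X"])
  also have "(- 1 :: 'a fps) ^ i = fps_const ((- 1) ^ i)"
    by (simp flip: fps_const_power fps_const_neg fps_const_1_eq_1)
  finally show ?thesis
    by (simp add: fps_compose_uminus' power_add mult_ac)
qed

text \<open>Conjugation by the substitution \<open>t \<mapsto> - t\<close> preserves composition. On coefficients: the sign
  that \<open>lam (eps_op A) $ i\<close> contributes cancels the dependence on \<open>i\<close> of the sign of the
  \<open>i\<close>th power.\<close>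

lemma eps_op_bullet: "eps_op (bullet A B) = bullet (eps_op A) (eps_op B)"
proof (rule iffD1[OF lam_inject], rule fps_ext)
  fix n
  have eps: "lam (eps_op C) $ k = (- 1) ^ (k + 1) * lam C $ k" for C :: "'a seq1" and k
    using lam_eps_op_power_nth[of C 1 k] by simp
  have "lam (eps_op A) $ i * (lam (eps_op B) ^ i) $ n =
      (- 1) ^ (n + 1) * (lam A $ i * (lam B ^ i) $ n)" for i
  proof -
    have "(- 1) ^ (i + 1) * (- 1) ^ (n + i) = (- 1 :: 'a) ^ (2 * i + (n + 1))"
      by (simp only: power_add[symmetric] mult_2 add_ac)
    also have "\<dots> = (- 1) ^ (n + 1)"
      by (simp add: power_add power_mult)
    finally have sgn: "(- 1) ^ (i + 1) * (- 1) ^ (n + i) = (- 1 :: 'a) ^ (n + 1)" .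
    have "lam (eps_op A) $ i * (lam (eps_op B) ^ i) $ n =
        (- 1) ^ (i + 1) * (- 1) ^ (n + i) * (lam A $ i * (lam B ^ i) $ n)"
      unfolding eps lam_eps_op_power_nth by (simp only: mult_ac)
    then show ?thesis unfolding sgn .
  qed
  then show "lam (eps_op (bullet A B)) $ n = lam (bullet (eps_op A) (eps_op B)) $ n"
    by (simp only: eps lam_bullet fps_compose_nth sum_distrib_left)
qed

section \<open>Invert and Binomial as translations by geometric sequences\<close>

definition geom :: "'a::comm_ring_1 \<Rightarrow> 'a seq1" where
  "geom x = Abs_seq1 (\<lambda>n. x ^ n)"

lemma seq_nth_geom [simp]: "seq_nth (geom x) n = x ^ n"
  by (simp add: geom_def Abs_seq1_inverse)

lemma lam_geom: "lam (geom x) * (1 - fps_const x * fps_X) = fps_X"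
proof (rule fps_ext)
  fix n
  have "lam (geom x) * (1 - fps_const x * fps_X) =
      lam (geom x) - fps_const x * (fps_X * lam (geom x))"
    by (simp add: algebra_simps)
  then show "(lam (geom x) * (1 - fps_const x * fps_X)) $ n = fps_X $ n"
    by (cases n; cases "n - 1") simp_all
qed

lemma geom_0: "geom 0 = one seq_group"
proof -
  have "lam (geom 0) = lam (one seq_group :: 'a seq1)"
    using lam_geom[of "0 :: 'a"] by (simp add: lam_one_seq_group)
  then show ?thesis by (simp add: lam_inject)
qed

text \<open>Substituting \<open>\<lambda>(A)\<close> for \<open>t\<close> in \<open>\<lambda>(geom x) (1 - x t) = t\<close> gives the equation that
  characterises the Invert transform. Its solution is unique because \<open>1 - x \<lambda>(A)\<close> is a unit.\<close>

lemma invert_op_eq_bullet: "invert_op x A = bullet (geom x) A"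
proof -
  let ?d = "1 - fps_const x * lam A"
  have d: "?d * fps_right_inverse ?d 1 = 1"
    by (rule fps_right_inverse) simp
  have "(lam (geom x) * (1 - fps_const x * fps_X)) oo lam A = (lam (geom x) oo lam A) * ?d"
    by (simp add: fps_compose_mult_distrib_comm_ring fps_compose_sub_distrib)
  then have "lam (bullet (geom x) A) * ?d = lam A"
    by (simp add: lam_geom lam_bullet)
  moreover have "lam (invert_op x A) * ?d = lam A"
    using ogf_invert_op[of x A] by (simp add: lam_eq mult.assoc)
  ultimately have "lam (invert_op x A) * (?d * fps_right_inverse ?d 1) =
      lam (bullet (geom x) A) * (?d * fps_right_inverse ?d 1)"
    by (simp only: mult.assoc[symmetric])
  then show ?thesis by (simp add: d lam_inject)
qed

text \<open>This is the expansion of \<open>(t / (1 - x t)) ^ (j + 1)\<close>. Multiplying by \<open>1 - x t\<close> turns one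
  factor into \<open>t\<close>, which on coefficients is Pascal's rule.\<close>

lemma lam_geom_power_nth:
  "(lam (geom x) ^ Suc j) $ Suc n = of_nat (n choose j) * x ^ (n - j)"
proof (induction n arbitrary: j)
  case 0
  then show ?case
    by (cases j) (simp_all add: startsby_zero_power_prefix fps_mult_nth fps_power_zeroth)
next
  case (Suc n)
  have "lam (geom x) ^ Suc j * (1 - fps_const x * fps_X) = fps_X * lam (geom x) ^ j"
    by (simp add: lam_geom mult.commute[of "lam (geom x)" "lam (geom x) ^ j"] mult.assoc
        mult.commute[of fps_X])
  then have unroll: "lam (geom x) ^ Suc j =
      fps_X * lam (geom x) ^ j + fps_const x * (fps_X * lam (geom x) ^ Suc j)"
    by (simp add: algebra_simps)
  have rec: "(lam (geom x) ^ Suc j) $ Suc (Suc n) =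
      (lam (geom x) ^ j) $ Suc n + x * (lam (geom x) ^ Suc j) $ Suc n"
    by (subst unroll) (simp del: power_Suc)
  show ?case
  proof (cases j)
    case 0
    then show ?thesis using rec Suc.IH[of 0] by simp
  next
    case j: (Suc i)
    show ?thesis
    proof (cases "j \<le> n")
      case True
      then have "n - i = Suc (n - j)" using j by simp
      then show ?thesis
        unfolding rec Suc.IH unfolding j Suc.IH by (simp add: j algebra_simps)
    next
      case False
      then show ?thesis
        unfolding rec Suc.IH unfolding j Suc.IH by (simp add: j binomial_eq_0)
    qed
  qed
qed

lemma binomial_op_eq_bullet: "binomial_op x A = bullet A (geom x)"
proof (rule seq1_eqI)
  fix n
  have "seq_nth (bullet A (geom x)) n = (lam A oo lam (geom x)) $ Suc n"
    by (simp flip: lam_bullet)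
  also have "\<dots> = (\<Sum>j=0..n. seq_nth A j * (lam (geom x) ^ Suc j) $ Suc n)"
    unfolding fps_compose_nth
    by (subst sum.atLeast0_atMost_Suc_shift) (simp del: power_Suc)
  also have "\<dots> = seq_nth (binomial_op x A) n"
    unfolding lam_geom_power_nth seq_nth_binomial_op by (simp add: mult_ac)
  finally show "seq_nth (binomial_op x A) n = seq_nth (bullet A (geom x)) n" ..
qed

text \<open>The product is the Binomial transform of a geometric sequence, which the binomial theorem
  evaluates.\<close>

lemma bullet_geom_geom: "bullet (geom x) (geom y) = geom (x + y)"
proof -
  have "binomial_op y (geom x) = geom (x + y)"
    by (rule seq1_eqI)
      (simp add: seq_nth_binomial_op binomial_ring[of x y] atLeast0AtMost mult_ac)
  then show ?thesis by (simp add: binomial_op_eq_bullet)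
qed

lemma eta_op_geom: "eta_op (geom x) = geom (- x)"
  by (rule eta_op_eqI) (simp add: bullet_geom_geom geom_0)

lemma eps_op_geom: "eps_op (geom x) = geom (- x)"
  by (rule seq1_eqI) (simp add: seq_nth_eps_op power_minus[of x])

lemma bullet_one_left: "bullet (geom 0) A = A"
  using group.is_monoid[OF group_seq_group, THEN monoid.l_one, of A] by (simp add: geom_0)

lemma bullet_one_right: "bullet A (geom 0) = A"
  using group.is_monoid[OF group_seq_group, THEN monoid.r_one, of A] by (simp add: geom_0)

section \<open>Identities between the operators\<close>

lemma surj_gamma_op: "surj gamma_op"
  by (rule surjI[of _ "eps_op \<circ> eta_op"]) (simp add: gamma_op_def eps_op_eps_op eta_op_eta_op)

lemma gamma_op_invert_op: "gamma_op (invert_op x A) = binomial_op x (gamma_op A)"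
  and gamma_op_binomial_op: "gamma_op (binomial_op x A) = invert_op x (gamma_op A)"
  by (simp_all add: gamma_op_def invert_op_eq_bullet binomial_op_eq_bullet
      eps_op_bullet eps_op_geom eta_op_bullet eta_op_geom)

theorem theorem1p16:
  fixes x y :: "'a::comm_ring_1"
  shows
    "(invert_op x \<circ> invert_op (- x) = id \<and> binomial_op x \<circ> binomial_op (- x) = id) \<and>
     (invert_op x \<circ> invert_op y = invert_op (x + y) \<and>
      binomial_op x \<circ> binomial_op y = binomial_op (x + y)) \<and>
     (invert_op x \<circ> eps_op = eps_op \<circ> invert_op (- x) \<and>
      binomial_op x \<circ> eps_op = eps_op \<circ> binomial_op (- x)) \<and>
     (invert_op x \<circ> binomial_op y = binomial_op y \<circ> invert_op x) \<and>
     (invert_op x \<circ> eta_op = eta_op \<circ> binomial_op (- x) \<and>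
      eta_op \<circ> invert_op x = binomial_op (- x) \<circ> eta_op) \<and>
     (gamma_op \<circ> invert_op x \<circ> inv_into UNIV gamma_op = binomial_op x \<and>
      gamma_op \<circ> binomial_op x \<circ> inv_into UNIV gamma_op = invert_op x)"
proof -
  have add: "invert_op x (invert_op y A) = invert_op (x + y) A"
    "binomial_op x (binomial_op y A) = binomial_op (x + y) A" for x y and A :: "'a seq1"
    by (simp_all add: invert_op_eq_bullet binomial_op_eq_bullet bullet_assoc bullet_geom_geom
        add.commute flip: bullet_assoc[of "geom x" "geom y"])
  have zero: "invert_op 0 A = A" "binomial_op 0 A = A" for A :: "'a seq1"
    by (simp_all add: invert_op_eq_bullet binomial_op_eq_bullet bullet_one_left bullet_one_right)
  have eps: "invert_op x (eps_op A) = eps_op (invert_op (- x) A)"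
    "binomial_op x (eps_op A) = eps_op (binomial_op (- x) A)" for A :: "'a seq1"
    by (simp_all add: invert_op_eq_bullet binomial_op_eq_bullet eps_op_bullet eps_op_geom)
  have comm: "invert_op x (binomial_op y A) = binomial_op y (invert_op x A)" for A :: "'a seq1"
    by (simp add: invert_op_eq_bullet binomial_op_eq_bullet bullet_assoc)
  have eta: "invert_op x (eta_op A) = eta_op (binomial_op (- x) A)"
    "eta_op (invert_op x A) = binomial_op (- x) (eta_op A)" for A :: "'a seq1"
    by (simp_all add: invert_op_eq_bullet binomial_op_eq_bullet eta_op_bullet eta_op_geom)
  have inv: "gamma_op (inv_into UNIV gamma_op A) = A" for A :: "'a seq1"
    using surj_gamma_op by (rule surj_f_inv_f)
  show ?thesis
    by (simp add: fun_eq_iff add zero eps comm eta inv gamma_op_invert_op gamma_op_binomial_op)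
qed

end
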